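(* Let $\mathcal T$ be the rooted labelled tree whose root (at level $0$) has label $(1,0)$, and in which every node with label $(a,b)$ has exactly $b$ children labelled $(a+1,b-1)$ and, for each $j\in\{1,\dots,a\}$, one child labelled $(a+1-j,\,b+j)$ (and no other children); children of a node at level $n$ are at level $n+1$. Then for every $n\geqslant 0$, the number of nodes of $\mathcal T$ at level $n$ equals $|\mathcal{I}_n(000,100)|$.
   Context: For $n\in\mathbb N$, an inversion sequence of size $n$ is a sequence $\sigma=(\sigma_1,\dots,\sigma_n)\in\mathbb N^n$ with $\sigma_i<i$ for all $i$. An integer sequence contains a pattern $\rho$ (a finite integer sequence such as $000$ or $100$) if it has a subsequence order-isomorphic to $\rho$, and avoids $\rho$ otherwise. $\mathcal{I}_n(P)$ denotes the set of inversion sequences of size $n$ avoiding every pattern in the set $P$. *)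

theory Defs
  imports Main "HOL-Library.Sublist"
begin

definition order_isomorphic :: "'a::linorder list \<Rightarrow> 'b::linorder list \<Rightarrow> bool" where
  "order_isomorphic xs ys \<longleftrightarrow> length xs = length ys \<and>
     (\<forall>i<length xs. \<forall>j<length xs. xs ! i < xs ! j \<longleftrightarrow> ys ! i < ys ! j)"

text \<open>Here \<^const>\<open>subseq\<close> is the not necessarily contiguous subsequence relation.\<close>

definition contains_pattern :: "'a::linorder list \<Rightarrow> 'b::linorder list \<Rightarrow> bool" where
  "contains_pattern xs \<rho> \<longleftrightarrow> (\<exists>ys. subseq ys xs \<and> order_isomorphic ys \<rho>)"

text \<open>The entry \<open>\<sigma> ! i\<close> is the mathematical \<open>\<sigma>\<close> with index \<open>i + 1\<close>, hence the bound \<open>i + 1\<close>.\<close>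

definition inversion_sequences :: "nat \<Rightarrow> nat list set" where
  "inversion_sequences n = {\<sigma>. length \<sigma> = n \<and> (\<forall>i<n. \<sigma> ! i < i + 1)}"

definition avoiding_inversion_sequences :: "nat \<Rightarrow> int list set \<Rightarrow> nat list set" where
  "avoiding_inversion_sequences n P =
     {\<sigma> \<in> inversion_sequences n. \<forall>\<rho>\<in>P. \<not> contains_pattern \<sigma> \<rho>}"

fun child_labels :: "nat \<times> nat \<Rightarrow> (nat \<times> nat) list" where
  "child_labels (a, b) =
     replicate b (a + 1, b - 1) @ map (\<lambda>j. (a + 1 - j, b + j)) [1..<a + 1]"

text \<open>A node is identified with its address: the list of child positions chosen along the path
  from the root to it. Thus siblings with equal labels are distinct nodes, and the level of a
  node is the length of its address. \<open>tree_node p l\<close> says that \<open>p\<close> is a node with label \<open>l\<close>.\<close>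

inductive tree_node :: "nat list \<Rightarrow> nat \<times> nat \<Rightarrow> bool" where
  root: "tree_node [] (1, 0)"
| child: "tree_node p l \<Longrightarrow> i < length (child_labels l) \<Longrightarrow>
     tree_node (p @ [i]) (child_labels l ! i)"

definition nodes_at_level :: "nat \<Rightarrow> nat list set" where
  "nodes_at_level n = {p. length p = n \<and> (\<exists>l. tree_node p l)}"

end

theory Submission imports Defs begin

text \<open>Avoiding 000 and 100 means having no subsequence \<open>w v v\<close> with \<open>v \<le> w\<close>. So \<open>x\<close> may be
  appended to an avoiding \<open>\<sigma>\<close> of length \<open>n\<close> iff \<open>x \<le> n\<close> and \<open>\<sigma>\<close> has no subsequence \<open>w x\<close> with
  \<open>x \<le> w\<close>; call the other values blocked. Let \<open>m\<close> be the maximum of \<open>\<sigma>\<close> (or \<open>-1\<close>) and label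
  \<open>\<sigma>\<close> by \<open>a = n - m\<close> and by the number \<open>b\<close> of unblocked values up to \<open>m\<close>. Appending one of these
  \<open>b\<close> values blocks it and nothing else, which gives \<open>(a + 1, b - 1)\<close>; appending
  \<open>m + j\<close> for \<open>1 \<le> j \<le> a\<close> blocks nothing and raises the maximum by \<open>j\<close>, which gives
  \<open>(a + 1 - j, b + j)\<close>. Hence appending letters follows the rule of the tree.\<close>

fun descendants :: "('l \<Rightarrow> 'l list) \<Rightarrow> nat \<Rightarrow> 'l \<Rightarrow> nat" where
  "descendants C 0 l = 1"
| "descendants C (Suc k) l = (\<Sum>l'\<leftarrow>C l. descendants C k l')"

text \<open>Used for the addresses of tree nodes and for the avoiding sequences: both counts equal
  \<open>descendants\<close>, so no bijection is built. As \<open>g\<close> is arbitrary,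
  \<open>sum\<close> says that the labels of the extensions agree with \<open>C (lab p)\<close> as
  multisets.\<close>

lemma card_extensions:
  assumes step: "\<And>p x. p @ [x] \<in> A \<longleftrightarrow> p \<in> A \<and> x \<in> ch p"
    and fin: "\<And>p. finite (ch p)"
    and sum: "\<And>p g. p \<in> A \<Longrightarrow>
      (\<Sum>x\<in>ch p. g (lab (p @ [x]))) = (\<Sum>l\<leftarrow>C (lab p). g l :: nat)"
    and "p \<in> A"
  shows "finite {q. length q = k \<and> p @ q \<in> A} \<and>
    card {q. length q = k \<and> p @ q \<in> A} = descendants C k (lab p)"
  using \<open>p \<in> A\<close>
proof (induction k arbitrary: p)
  case 0
  then have "{q. length q = 0 \<and> p @ q \<in> A} = {[]}" by auto
  then show ?case by simp
next
  case (Suc k)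
  \<comment> \<open>The recursion splits off the first letter after \<open>p\<close>, while
    \<open>step\<close> concerns the last one; closure under prefixes bridges the two.\<close>
  have prefix: "p \<in> A" if "p @ q \<in> A" for p q
    using that by (induction q rule: rev_induct) (auto simp: step simp flip: append_assoc)
  let ?E = "\<lambda>x. {q. length q = k \<and> (p @ [x]) @ q \<in> A}"
  have IH: "finite (?E x)" "card (?E x) = descendants C k (lab (p @ [x]))" if "x \<in> ch p" for x
    using Suc.IH[of "p @ [x]"] Suc.prems that step by blast+
  have "{q. length q = Suc k \<and> p @ q \<in> A} = (\<Union>x\<in>ch p. (#) x ` ?E x)"
  proof (intro set_eqI iffI)
    fix q assume "q \<in> {q. length q = Suc k \<and> p @ q \<in> A}"
    then obtain x r where q: "q = x # r" "length r = k" "(p @ [x]) @ r \<in> A"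
      by (cases q) auto
    moreover have "x \<in> ch p"
      using prefix[OF q(3)] step by blast
    ultimately show "q \<in> (\<Union>x\<in>ch p. (#) x ` ?E x)" by blast
  qed auto
  moreover have "card (\<Union>x\<in>ch p. (#) x ` ?E x) = (\<Sum>x\<in>ch p. card ((#) x ` ?E x))"
    by (rule card_UN_disjoint) (use fin IH in auto)
  moreover have "\<dots> = (\<Sum>x\<in>ch p. descendants C k (lab (p @ [x])))"
    by (rule sum.cong) (use IH in \<open>auto simp: card_image\<close>)
  ultimately show ?case
    using sum[OF Suc.prems] fin IH by simp
qed

text \<open>Addresses outside the tree get a value too, so nodes are recovered as those
  \<open>p\<close> with \<open>tree_node p (node_label p)\<close>.\<close>

definition node_label :: "nat list \<Rightarrow> nat \<times> nat" where
  "node_label p = foldl (\<lambda>l i. child_labels l ! i) (1, 0) p"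

lemma node_label_simps [simp]:
  "node_label [] = (1, 0)"
  "node_label (p @ [i]) = child_labels (node_label p) ! i"
  by (simp_all add: node_label_def)

lemma tree_node_label: "tree_node p l \<Longrightarrow> l = node_label p"
  by (induction rule: tree_node.induct) simp_all

lemma tree_node_snoc:
  "tree_node (p @ [i]) (node_label (p @ [i])) \<longleftrightarrow>
    tree_node p (node_label p) \<and> i < length (child_labels (node_label p))"
proof
  assume "tree_node (p @ [i]) (node_label (p @ [i]))"
  then show "tree_node p (node_label p) \<and> i < length (child_labels (node_label p))"
    by cases (use tree_node_label in auto)
qed (auto intro: tree_node.child)

lemma card_nodes_at_level: "card (nodes_at_level n) = descendants child_labels n (1, 0)"
proof -
  let ?A = "{p. tree_node p (node_label p)}"
  let ?ch = "\<lambda>p. {..<length (child_labels (node_label p))}"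
  have "card {q. length q = n \<and> [] @ q \<in> ?A} = descendants child_labels n (node_label [])"
  proof (rule conjunct2[OF card_extensions[where ch = ?ch]])
    show "(\<Sum>x\<in>?ch p. g (node_label (p @ [x]))) =
        (\<Sum>l\<leftarrow>child_labels (node_label p). g l)" for p and g :: "nat \<times> nat \<Rightarrow> nat"
      by (simp add: sum_list_sum_nth atLeast0LessThan del: child_labels.simps)
  qed (use tree_node_snoc tree_node.root in auto)
  moreover have "nodes_at_level n = {q. length q = n \<and> [] @ q \<in> ?A}"
    using tree_node_label unfolding nodes_at_level_def by fastforce
  ultimately show ?thesis by simp
qed

text \<open>Sequences grow on the right, so the case split is on whether the last letter
  \<open>y\<close> is matched with the new letter \<open>x\<close>.\<close>

lemma subseq_snoc_iff:
  "subseq (ys @ [y]) (xs @ [x]) \<longleftrightarrow> subseq (ys @ [y]) xs \<or> y = x \<and> subseq ys xs"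
proof
  assume "subseq (ys @ [y]) (xs @ [x])"
  then obtain us vs where split: "ys @ [y] = us @ vs" "subseq us xs" "subseq vs [x]"
    by (auto simp: subseq_append_iff)
  then have "vs = [] \<or> vs = [x]"
    by (cases vs) (auto split: if_splits)
  then show "subseq (ys @ [y]) xs \<or> y = x \<and> subseq ys xs"
    using split by auto
qed (auto intro: subseq_rev_drop_many)

definition blocked :: "nat list \<Rightarrow> nat set" where
  "blocked \<sigma> = {v. \<exists>w\<ge>v. subseq [w, v] \<sigma>}"

text \<open>One more than the maximum, so that the value -1 for the empty sequence becomes 0 and
  everything stays in the naturals.\<close>

definition bound :: "nat list \<Rightarrow> nat" where
  "bound \<sigma> = fold max (map Suc \<sigma>) 0"

lemma bound_simps [simp]:
  "bound [] = 0"
  "bound (\<sigma> @ [x]) = max (Suc x) (bound \<sigma>)"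
  by (simp_all add: bound_def)

lemma less_bound_iff: "x < bound \<sigma> \<longleftrightarrow> (\<exists>w\<in>set \<sigma>. x \<le> w)"
  by (induction \<sigma> rule: rev_induct) (auto simp: less_max_iff_disj)

lemma blocked_Nil [simp]: "blocked [] = {}"
  by (simp add: blocked_def)

text \<open>A new pair ends in the appended \<open>x\<close>, and an earlier entry at least
  \<open>x\<close> exists exactly when \<open>x < bound \<sigma>\<close>.\<close>

lemma blocked_snoc:
  "blocked (\<sigma> @ [x]) = blocked \<sigma> \<union> (if x < bound \<sigma> then {x} else {})"
proof -
  have "subseq [w, v] (\<sigma> @ [x]) \<longleftrightarrow> subseq [w, v] \<sigma> \<or> v = x \<and> w \<in> set \<sigma>" for v w
    using subseq_snoc_iff[of "[w]" v \<sigma> x] by (simp add: subseq_singleton_left)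
  then show ?thesis by (auto simp: blocked_def less_bound_iff)
qed

lemma blocked_subset: "blocked \<sigma> \<subseteq> {..<bound \<sigma>}"
  by (induction \<sigma> rule: rev_induct) (auto simp: blocked_snoc less_max_iff_disj)

definition seq_label :: "nat list \<Rightarrow> nat \<times> nat" where
  "seq_label \<sigma> = (Suc (length \<sigma>) - bound \<sigma>, card ({..<bound \<sigma>} - blocked \<sigma>))"

lemma sum_appendable_labels:
  assumes "bound \<sigma> \<le> length \<sigma>"
  shows "(\<Sum>x\<in>{..length \<sigma>} - blocked \<sigma>. g (seq_label (\<sigma> @ [x]))) =
    (\<Sum>l\<leftarrow>child_labels (seq_label \<sigma>). g l :: nat)"
proof -
  \<comment> \<open>This \<open>m\<close> exceeds the maximum by one, hence \<open>Suc n - m\<close>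
    for \<open>a\<close> below.\<close>
  define n m where "n = length \<sigma>" and "m = bound \<sigma>"
  define U where "U = {..<m} - blocked \<sigma>"
  define a b where "a = Suc n - m" and "b = card U"
  have "m \<le> n" using assms by (simp add: n_def m_def)
  have [simp]: "finite U" by (simp add: U_def)
  have low: "seq_label (\<sigma> @ [x]) = (a + 1, b - 1)" if "x \<in> U" for x
  proof -
    have "x < m" using that by (simp add: U_def)
    then have "{..<bound (\<sigma> @ [x])} - blocked (\<sigma> @ [x]) = U - {x}"
      by (auto simp: blocked_snoc U_def m_def)
    then show ?thesis
      using that \<open>x < m\<close> \<open>m \<le> n\<close> unfolding seq_label_def
      by (simp add: a_def b_def n_def m_def)
  qed
  \<comment> \<open>The letter \<open>j + m - 1\<close> lies \<open>j\<close> above the old maximum.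
    The values from \<open>m\<close> up to this letter now count as well, and none of them is
    blocked, since blocked values of \<open>\<sigma>\<close> lie below \<open>m\<close>.\<close>
  have high: "seq_label (\<sigma> @ [j + m - 1]) = (a + 1 - j, b + j)" if "j \<in> {1..<a + 1}" for j
  proof -
    have "{..<bound (\<sigma> @ [j + m - 1])} - blocked (\<sigma> @ [j + m - 1]) = U \<union> {m..<m + j}"
      using that blocked_subset[of \<sigma>] by (auto simp: blocked_snoc U_def m_def)
    moreover have "card (U \<union> {m..<m + j}) = b + j"
      by (subst card_Un_disjoint) (auto simp: U_def b_def)
    ultimately show ?thesis
      using that \<open>m \<le> n\<close> unfolding seq_label_def
      by (auto simp: a_def n_def m_def)
  qed
  have "{..n} - blocked \<sigma> = U \<union> {m..n}"
    using \<open>m \<le> n\<close> blocked_subset[of \<sigma>] by (auto simp: U_def m_def)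
  moreover have "U \<inter> {m..n} = {}" by (auto simp: U_def)
  ultimately have "(\<Sum>x\<in>{..n} - blocked \<sigma>. g (seq_label (\<sigma> @ [x]))) =
      (\<Sum>x\<in>U. g (seq_label (\<sigma> @ [x]))) + (\<Sum>x\<in>{m..n}. g (seq_label (\<sigma> @ [x])))"
    by (simp add: sum.union_disjoint)
  also have "(\<Sum>x\<in>U. g (seq_label (\<sigma> @ [x]))) = b * g (a + 1, b - 1)"
    by (simp add: low b_def)
  also have "(\<Sum>x\<in>{m..n}. g (seq_label (\<sigma> @ [x]))) =
      (\<Sum>j\<in>{1..<a + 1}. g (seq_label (\<sigma> @ [j + m - 1])))"
    by (rule sum.reindex_bij_witness[where i = "\<lambda>j. j + m - 1" and j = "\<lambda>x. x + 1 - m"])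
      (use \<open>m \<le> n\<close> in \<open>auto simp: a_def\<close>)
  also have "\<dots> = (\<Sum>j\<in>{1..<a + 1}. g (a + 1 - j, b + j))"
    by (simp only: high cong: sum.cong)
  finally show ?thesis
    by (simp add: seq_label_def a_def b_def n_def m_def U_def sum_list_replicate
        interv_sum_list_conv_sum_set_nat o_def del: upt_Suc)
qed

text \<open>The case \<open>v = w\<close> is the pattern 000 and \<open>v < w\<close> is
  100.\<close>

lemma contains_000_or_100_iff:
  fixes \<sigma> :: "nat list"
  shows "contains_pattern \<sigma> [0, 0, 0 :: int] \<or> contains_pattern \<sigma> [1, 0, 0 :: int] \<longleftrightarrow>
    (\<exists>v w. v \<le> w \<and> subseq [w, v, v] \<sigma>)"
proof -
  have three: "(\<forall>i<Suc (Suc (Suc 0)). P i) \<longleftrightarrow> P 0 \<and> P 1 \<and> P 2" for P :: "nat \<Rightarrow> bool"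
    by (auto simp: numeral_eq_Suc less_Suc_eq)
  \<comment> \<open>Comparing an index with itself says nothing, which leaves six of the nine
    comparisons.\<close>
  have iso_three: "order_isomorphic ys [a, b, c :: int] \<longleftrightarrow>
      (\<exists>x y z. ys = [x, y, z] \<and> (x < y \<longleftrightarrow> a < b) \<and> (y < x \<longleftrightarrow> b < a) \<and>
        (x < z \<longleftrightarrow> a < c) \<and> (z < x \<longleftrightarrow> c < a) \<and> (y < z \<longleftrightarrow> b < c) \<and> (z < y \<longleftrightarrow> c < b))"
    for ys :: "nat list" and a b c
  proof (cases "length ys = 3")
    case True
    then obtain x y z where "ys = [x, y, z]"
      by (auto simp: numeral_3_eq_3 length_Suc_conv)
    then show ?thesis
      by (simp add: order_isomorphic_def three) argo
  qed (auto simp: order_isomorphic_def)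
  have "order_isomorphic ys [0, 0, 0 :: int] \<longleftrightarrow> (\<exists>v. ys = [v, v, v])" for ys :: "nat list"
    by (auto simp: iso_three)
  moreover have "order_isomorphic ys [1, 0, 0 :: int] \<longleftrightarrow> (\<exists>v w. v < w \<and> ys = [w, v, v])"
    for ys :: "nat list"
    by (auto simp: iso_three)
  ultimately show ?thesis
    unfolding contains_pattern_def by (auto simp: le_less)
qed

text \<open>All sizes are united because \<open>card_extensions\<close> works in a single set closed
  under prefixes.\<close>

definition avoiders :: "nat list set" where
  "avoiders = (\<Union>n. avoiding_inversion_sequences n {[0, 0, 0], [1, 0, 0]})"

lemma mem_avoiders_iff:
  "\<sigma> \<in> avoiders \<longleftrightarrow>
    (\<forall>i<length \<sigma>. \<sigma> ! i \<le> i) \<and> (\<forall>v w. v \<le> w \<longrightarrow> \<not> subseq [w, v, v] \<sigma>)"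
  using contains_000_or_100_iff[of \<sigma>]
  by (auto simp: avoiders_def avoiding_inversion_sequences_def inversion_sequences_def
      less_Suc_eq_le)

text \<open>A forbidden \<open>w v v\<close> that is new must end in the appended letter, so
  \<open>v = x\<close> and \<open>w x\<close> already occurs in \<open>\<sigma>\<close>.\<close>

lemma snoc_mem_avoiders_iff:
  "\<sigma> @ [x] \<in> avoiders \<longleftrightarrow> \<sigma> \<in> avoiders \<and> x \<in> {..length \<sigma>} - blocked \<sigma>"
  using subseq_snoc_iff[of "[w, v]" v \<sigma> x for w v]
  by (auto simp: mem_avoiders_iff blocked_def nth_append less_Suc_eq)

lemma bound_le_length: "\<sigma> \<in> avoiders \<Longrightarrow> bound \<sigma> \<le> length \<sigma>"
  by (induction \<sigma> rule: rev_induct) (auto simp: snoc_mem_avoiders_iff)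

lemma card_avoiders:
  "card (avoiding_inversion_sequences n {[0, 0, 0], [1, 0, 0]}) =
    descendants child_labels n (1, 0)"
proof -
  have "card {q. length q = n \<and> [] @ q \<in> avoiders} =
      descendants child_labels n (seq_label [])"
    by (rule conjunct2[OF card_extensions[where ch = "\<lambda>\<sigma>. {..length \<sigma>} - blocked \<sigma>"]])
      (use snoc_mem_avoiders_iff sum_appendable_labels bound_le_length in
        \<open>auto simp: mem_avoiders_iff simp del: child_labels.simps\<close>)
  moreover have "avoiding_inversion_sequences n {[0, 0, 0], [1, 0, 0]} =
      {q. length q = n \<and> [] @ q \<in> avoiders}"
    by (auto simp: avoiders_def avoiding_inversion_sequences_def inversion_sequences_def)
  ultimately show ?thesis by (simp add: seq_label_def)
qed

theorem theorem1:
  fixes n :: nat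
  shows "card (nodes_at_level n) =
    card (avoiding_inversion_sequences n {[0, 0, 0], [1, 0, 0]})"
  by (simp only: card_nodes_at_level card_avoiders)

end
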